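(* Let $\alpha \in [0,1)$ and let $g$ be a univalent meromorphic function on $\mathbb{D}$ of the form $g(z)=\frac{1}{z}+a_0+a_1z+\cdots$. Then $g$ is meromorphically inverse convex of order $\alpha$ on the disk $\{|z|<r_\alpha\}$, where $r_\alpha$ is the unique zero in $(0,1)$ of the polynomial $$P_\alpha(x)=(-1-\alpha)x^2+4x+\alpha-1.$$ The radius $r_\alpha$ is sharp: for every $r>r_\alpha$ it is false that every such univalent meromorphic function $g$ is meromorphically inverse convex of order $\alpha$ on the disk $\{|z|<r\}$.
   Context: $\mathbb{D}=\{z\in\mathbb{C}:|z|<1\}$. A function $f$ analytic on $\mathbb{D}$ with $f(0)=0$, $f'(0)=1$, univalent, is convex of order $\alpha$ if ${\operatorname{Re}}\left(1+\frac{zf''(z)}{f'(z)}\right)\geq\alpha$ in $\mathbb{D}$. A meromorphic function $g$ on $\mathbb{D}$ of the form $g(z)=\frac{1}{z}+a_0+a_1z+\cdots$ is meromorphically inverse convex of order $\alpha$ if there is a function $f$ convex of order $\alpha$ with $g(z)f(z)=1$ for $z\in\mathbb{D}\setminus\{0\}$; equivalently, $g$ is univalent and ${\operatorname{Re}}\left(1+\frac{zg''(z)}{g'(z)}-\frac{2zg'(z)}{g(z)}\right)\geq\alpha$. Being meromorphically inverse convex of order $\alpha$ on the disk of radius $r$ means this inequality holds for $|z|<r$ (i.e. $1/g$ is convex of order $\alpha$ there).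
   Formalization: The formal theorem also assumes g has no zero in the punctured disk (else false: g(z)=1/z+c with |c| large fails near z=-1/c), and takes r_α as a given zero of P_α in (0,1), proving its uniqueness; existence is immediate from P_α(0)<0<P_α(1). *)

theory Defs
  imports "HOL-Complex_Analysis.Complex_Analysis"
begin

text \<open>The class: meromorphic on the unit disk with g(z) = 1/z + a0 + a1 z + ...,
  univalent, and nonvanishing on the punctured disk (so that 1/g is analytic,
  i.e. 1/g belongs to the class S).\<close>
definition univalent_mero :: "(complex \<Rightarrow> complex) \<Rightarrow> bool" where
  "univalent_mero g \<longleftrightarrow>
     (\<exists>h. h holomorphic_on ball 0 1 \<and> (\<forall>z \<in> ball 0 1 - {0}. g z = 1 / z + h z))
     \<and> inj_on g (ball 0 1 - {0})
     \<and> (\<forall>z \<in> ball 0 1 - {0}. g z \<noteq> 0)"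

text \<open>Meromorphically inverse convex of order alpha on the disk of radius r
  (the condition at z = 0 holds automatically in the limit, value 1).\<close>
definition mero_inv_convex_on :: "real \<Rightarrow> real \<Rightarrow> (complex \<Rightarrow> complex) \<Rightarrow> bool" where
  "mero_inv_convex_on \<alpha> r g \<longleftrightarrow>
     (\<forall>z. 0 < norm z \<and> norm z < r \<longrightarrow>
        g z \<noteq> 0 \<and> deriv g z \<noteq> 0 \<and>
        Re (1 + z * deriv (deriv g) z / deriv g z - 2 * z * deriv g z / g z) \<ge> \<alpha>)"

definition P_alpha :: "real \<Rightarrow> real \<Rightarrow> real" where
  "P_alpha \<alpha> x = (-1 - \<alpha>) * x^2 + 4 * x + \<alpha> - 1"

end

theory Submission
  imports Defs
begin

text \<open>
  For univalent \<open>g\<close> the function \<open>f = 1/g\<close> belongs to the class S, and the expression defining inverse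
  convexity equals \<open>1 + z f''(z)/f'(z)\<close>. Bieberbach's inequality \<open>|a\<^sub>2| \<le> 2\<close>, applied to the Koebe transform
  of \<open>f\<close> at \<open>z\<close>, gives \<open>|(1 - |z|\<^sup>2) f''(z)/f'(z) - 2 cnj z| \<le> 4\<close>, hence the lower bound
  \<open>(1 - 4|z| + |z|\<^sup>2) / (1 - |z|\<^sup>2)\<close>, which is at least \<open>\<alpha>\<close> exactly when \<open>P_alpha \<alpha> |z| \<le> 0\<close>. Equality holds
  for the Koebe function on the negative real axis.

  Bieberbach's inequality follows from the area theorem by the square-root transform. For the area
  theorem, the image of the annulus \<open>r < |z| < R\<close> under \<open>G(z) = 1/z + c z + ...\<close> lies inside the curve
  \<open>G(|z| = r)\<close>, which is an ellipse up to \<open>O(r\<^sup>2)\<close>, so its area is at most \<open>pi/r\<^sup>2 + O(r)\<close>. On the other hand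
  it is the integral of \<open>|G'|\<^sup>2\<close>, which is at least \<open>pi (1/r\<^sup>2 - 1/R\<^sup>2 + |c|\<^sup>2 (R\<^sup>2 - r\<^sup>2))\<close>. Letting \<open>r\<close> tend to 0
  and \<open>R\<close> to 1 gives \<open>|c| \<le> 1\<close>.
\<close>

(* Otherwise $ is ambiguous between vectors and formal power series. *)
no_notation fps_nth (infixl \<open>$\<close> 75)

section \<open>The area theorem\<close>

text \<open>Cauchy's integral formula at the centre: with u = \<open>of_real \<rho> * cis t\<close>,
  the kernel 1/u cancels the speed i u of the parametrisation, up to the constant i.\<close>

lemma mean_value_circle:
  fixes f :: "complex \<Rightarrow> complex"
  assumes f: "f holomorphic_on ball 0 R" and \<rho>: "0 < \<rho>" "\<rho> < R"
  shows "((\<lambda>t. f (of_real \<rho> * cis t)) has_integral (2 * pi * f 0)) {0..2*pi}"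
proof -
  have "((\<lambda>u. f u / (u - 0)) has_contour_integral (2 * of_real pi * \<i> * f 0)) (circlepath 0 \<rho>)"
    using \<rho> by (intro Cauchy_integral_circlepath_simple holomorphic_on_subset[OF f]) auto
  then have "((\<lambda>t. f (of_real \<rho> * cis t) / (of_real \<rho> * cis t) * \<rho> * \<i> * cis t) has_integral
      (2 * of_real pi * \<i> * f 0)) {0..2*pi}"
    unfolding circlepath_def by (subst (asm) has_contour_integral_part_circlepath_iff) auto
  then have "((\<lambda>t. - \<i> * (f (of_real \<rho> * cis t) / (of_real \<rho> * cis t) * \<rho> * \<i> * cis t)) has_integral
      (- \<i> * (2 * of_real pi * \<i> * f 0))) {0..2*pi}"
    by (rule has_integral_mult_right)
  moreover have "- \<i> * (f (of_real \<rho> * cis t) / (of_real \<rho> * cis t) * \<rho> * \<i> * cis t) = f (of_real \<rho> * cis t)" for t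
    using \<rho> by (simp add: field_simps)
  ultimately show ?thesis by (simp add: mult_ac)
qed

text \<open>Passes from pairs of reals, where the iterated integrals live, to \<open>real^2\<close>,
  where the Jacobian formula for the measure of an image applies. Identifying the coordinates maps
  boxes onto boxes of equal content.\<close>

lemma has_integral_vec2_if_has_integral_prod:
  fixes f :: "real \<times> real \<Rightarrow> 'b::banach" and a b c d :: real
  assumes "(f has_integral i) (cbox (a, c) (b, d))"
  shows "((\<lambda>x::real^2. f (x $ 1, x $ 2)) has_integral i) (cbox (vector [a, c]) (vector [b, d]))"
proof -
  define g :: "real^2 \<Rightarrow> real \<times> real" where "g = (\<lambda>x. (x $ 1, x $ 2))"
  define h :: "real \<times> real \<Rightarrow> real^2" where "h = (\<lambda>p. vector [fst p, snd p])"
  have hg: "h (g x) = x" for x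
    by (simp add: h_def g_def vec_eq_iff forall_2)
  have gh: "g (h p) = p" for p
    by (simp add: h_def g_def)
  have mem: "x \<in> cbox u v \<longleftrightarrow> g x \<in> cbox (g u) (g v)" for x u v
    by (auto simp: g_def mem_box_cart forall_2 cbox_Pair_eq)
  have gi: "g ` cbox u v = cbox (g u) (g v)" for u v
    using mem gh by (auto simp: image_iff) metis
  have hi: "h ` cbox p q = cbox (h p) (h q)" for p q
  proof (intro set_eqI iffI)
    fix x assume "x \<in> cbox (h p) (h q)"
    then have "g x \<in> cbox p q" using mem gh by simp
    then show "x \<in> h ` cbox p q" by (metis hg imageI)
  qed (auto simp: mem gh simp del: cbox_Pair_iff)
  have ct: "measure lborel (g ` cbox u v) = 1 * measure lborel (cbox u v)" for u v
  proof (cases "cbox u v = {}")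
    case False
    then show ?thesis
      unfolding gi using content_Pair[of "u $ 1" "u $ 2" "v $ 1" "v $ 2"]
      by (auto simp: g_def content_cbox_cart interval_eq_empty_cart forall_2 UNIV_2 not_less)
  qed simp
  have "((\<lambda>x. f (g x)) has_integral (1 / 1) *\<^sub>R i) (h ` cbox (a, c) (b, d))"
  proof (rule has_integral_twiddle[OF zero_less_one hg gh _ _ _ ct assms])
    show "continuous (at x) g" for x
      unfolding g_def by (intro continuous_intros)
  qed (use gi hi in blast)+
  then show ?thesis
    by (simp add: hi) (simp add: g_def h_def)
qed

text \<open>
  The holomorphic map is post-composed with \<open>w - \<kappa> cnj w\<close>, so that the area of an ellipse can be bounded
  by that of a disc, and pre-composed with the exponential, so that integrating over a rectangle gives
  polar coordinates. The Jacobian is \<open>(1 - |\<kappa>|\<^sup>2) |z G'(z)|\<^sup>2\<close>.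
\<close>

lemma area_image_lower_bound:
  fixes G :: "complex \<Rightarrow> complex" and \<kappa> :: complex
  assumes U: "open U" "G holomorphic_on U" "inj_on G U"
    and r: "0 < r" "r < R" and sub: "cball 0 R - ball 0 r \<subseteq> U"
    and \<kappa>: "cmod \<kappa> < 1"
    and bd: "\<And>z. z \<in> U \<Longrightarrow> r < cmod z \<Longrightarrow> cmod z < R \<Longrightarrow> cmod (G z - \<kappa> * cnj (G z)) \<le> B"
    and B: "B \<ge> 0"
    and m: "(m has_integral M) {ln r..ln R}"
    and m_le: "\<And>t. t \<in> {ln r..ln R} \<Longrightarrow> m t \<le> integral {0..2*pi}
      (\<lambda>s. (cmod (of_real (exp t) * cis s * deriv G (of_real (exp t) * cis s)))\<^sup>2)"
  shows "(1 - (cmod \<kappa>)\<^sup>2) * M \<le> pi * B\<^sup>2"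
proof -
  define J where "J = (\<lambda>z. (cmod (z * deriv G z))\<^sup>2)"
  define C where "C = (\<lambda>x::real^2. Complex (x $ 1) (x $ 2))"
  define T where "T = (\<lambda>w. w - \<kappa> * cnj w)"
  define V where "V = (\<lambda>w. vector [Re w, Im w] :: real^2)"
  define \<Phi> where "\<Phi> = (\<lambda>x. V (T (G (exp (C x)))))"
  define \<Phi>' where "\<Phi>' = (\<lambda>x v. V (T (exp (C x) * deriv G (exp (C x)) * C v)))"
  \<comment> \<open>The open box keeps the argument strictly between 0 and 2 pi, where
    \<open>exp\<close> is injective. The faces left out do not affect the integral.\<close>
  define S where "S = box (vector [ln r, 0] :: real^2) (vector [ln R, 2*pi])"
  have R: "0 < R" using r by simp
  have Ceq: "C x = of_real (x $ 1) + \<i> * of_real (x $ 2)" for x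
    by (simp add: C_def complex_eq_iff)
  have blC: "bounded_linear C"
    unfolding Ceq by (intro bounded_linear_add bounded_linear_compose[OF bounded_linear_of_real]
        bounded_linear_compose[OF bounded_linear_mult_right] bounded_linear_vec_nth)
  have Veq: "V w = Re w *\<^sub>R axis 1 1 + Im w *\<^sub>R axis 2 1" for w
    by (simp add: V_def vec_eq_iff forall_2 axis_def)
  have blV: "bounded_linear V"
    unfolding Veq by (intro bounded_linear_add bounded_linear_scaleR_left
       bounded_linear_compose[OF bounded_linear_scaleR_left bounded_linear_Re]
       bounded_linear_compose[OF bounded_linear_scaleR_left bounded_linear_Im])
  have blT: "bounded_linear T"
    unfolding T_def by (intro bounded_linear_sub bounded_linear_ident
       bounded_linear_compose[OF bounded_linear_mult_right bounded_linear_cnj])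
  have normV: "norm (V w) = cmod w" for w
    by (simp add: V_def norm_vec_def L2_set_def UNIV_2 cmod_def)
  have injV: "V w = V w' \<Longrightarrow> w = w'" for w w'
    by (metis V_def complex_eq_iff vector_2)
  have injC: "C w = C w' \<Longrightarrow> w = w'" for w w'
    by (simp add: C_def vec_eq_iff forall_2)
  \<comment> \<open>A nonzero difference w - w' would have the same modulus as its multiple by
    \<open>\<kappa>\<close>, against |\<open>\<kappa>\<close>| < 1.\<close>
  have injT: "w = w'" if "T w = T w'" for w w'
  proof (rule ccontr)
    assume "w \<noteq> w'"
    have "w - w' = \<kappa> * cnj (w - w')"
      using that by (simp add: T_def algebra_simps)
    then have "cmod (w - w') = cmod \<kappa> * cmod (w - w')"
      by (metis complex_mod_cnj norm_mult)
    with \<open>w \<noteq> w'\<close> \<kappa> show False by simp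
  qed
  have S_iff: "x \<in> S \<longleftrightarrow> ln r < x $ 1 \<and> x $ 1 < ln R \<and> 0 < x $ 2 \<and> x $ 2 < 2*pi" for x
    by (auto simp: S_def mem_box_cart forall_2)
  have cmodexp: "cmod (exp (C x)) = exp (x $ 1)" for x
    by (simp add: C_def)
  have bnds: "r < cmod (exp (C x)) \<and> cmod (exp (C x)) < R" if "x \<in> S" for x
    using that r R unfolding cmodexp S_iff by (metis exp_less_mono exp_ln)
  then have inU: "exp (C x) \<in> U" if "x \<in> S" for x
    using sub that by force
  have der: "(\<Phi> has_derivative \<Phi>' x) (at x within S)" if "x \<in> S" for x
  proof -
    have 1: "((\<lambda>w. G (exp w)) has_field_derivative exp (C x) * deriv G (exp (C x))) (at (C x))"
      using DERIV_chain2[OF holomorphic_derivI[OF U(2,1) inU[OF that]] DERIV_exp]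
      by (simp add: mult.commute)
    have 2: "(C has_derivative C) (at x within S)"
      by (rule bounded_linear_imp_has_derivative[OF blC])
    have "((\<lambda>x. G (exp (C x))) has_derivative (\<lambda>v. exp (C x) * deriv G (exp (C x)) * C v)) (at x within S)"
      using has_derivative_compose[OF 2 1[unfolded has_field_derivative_def]] by simp
    then have "((\<lambda>x. T (G (exp (C x)))) has_derivative (\<lambda>v. T (exp (C x) * deriv G (exp (C x)) * C v))) (at x within S)"
      by (rule bounded_linear.has_derivative[OF blT])
    then show ?thesis
      unfolding \<Phi>_def \<Phi>'_def by (rule bounded_linear.has_derivative[OF blV])
  qed
  have inj: "inj_on \<Phi> S"
  proof (rule inj_onI)
    fix x y assume "x \<in> S" "y \<in> S" "\<Phi> x = \<Phi> y"
    then have "exp (C x) = exp (C y)"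
      using injV injT inU inj_onD[OF U(3)] unfolding \<Phi>_def by metis
    moreover have "\<bar>Im (C x) - Im (C y)\<bar> < 2 * pi"
      using \<open>x \<in> S\<close> \<open>y \<in> S\<close> by (auto simp: S_iff C_def)
    ultimately show "x = y" using exp_complex_eqI injC by blast
  qed
  have det: "\<bar>det (matrix (\<Phi>' x))\<bar> = (1 - (cmod \<kappa>)\<^sup>2) * J (exp (C x))" for x
  proof -
    have "det (matrix (\<Phi>' x)) = (1 - (cmod \<kappa>)\<^sup>2) * J (exp (C x))"
    proof -
      define u where "u = exp (C x) * deriv G (exp (C x))"
      have e: "C (axis 1 1) = 1" "C (axis 2 1) = \<i>"
        by (simp_all add: C_def axis_def complex_eq_iff)
      \<comment> \<open>The columns of the matrix are the images of 1 and i. Multiplication by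
        \<open>u\<close> contributes the factor |u|^2 and \<open>T\<close> contributes 1 -
        |\<open>\<kappa>\<close>|^2.\<close>
      have "det (matrix (\<Phi>' x)) = Re (T u) * Im (T (u * \<i>)) - Re (T (u * \<i>)) * Im (T u)"
        unfolding det_2 matrix_def \<Phi>'_def u_def[symmetric] by (simp add: e V_def)
      also have "\<dots> = (1 - (cmod \<kappa>)\<^sup>2) * (cmod u)\<^sup>2"
        unfolding cmod_power2 T_def by (simp add: algebra_simps power2_eq_square)
      finally show ?thesis by (simp add: u_def J_def)
    qed
    moreover have "(cmod \<kappa>)\<^sup>2 \<le> 1" using \<kappa> by (simp add: power_le_one)
    ultimately show ?thesis by (simp add: J_def)
  qed
  define F where "F = (\<lambda>p::real\<times>real. J (complex_of_real (exp (fst p)) * cis (snd p)))"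
  have contF: "continuous_on (cbox (ln r, 0) (ln R, 2*pi)) F"
  proof -
    have contG: "continuous_on U (deriv G)"
      using U by (intro holomorphic_on_imp_continuous_on holomorphic_deriv)
    have memU: "complex_of_real (exp (fst p)) * cis (snd p) \<in> U" if "p \<in> cbox (ln r, 0) (ln R, 2*pi)" for p
    proof -
      have "ln r \<le> fst p" "fst p \<le> ln R" using that by (auto simp: cbox_Pair_eq)
      then have "r \<le> exp (fst p)" "exp (fst p) \<le> R"
        using r R by (metis exp_le_cancel_iff exp_ln)+
      then show ?thesis using sub by (auto simp: norm_mult)
    qed
    have contE: "continuous_on (cbox (ln r, 0) (ln R, 2*pi))
        (\<lambda>p::real\<times>real. complex_of_real (exp (fst p)) * cis (snd p))"
      by (intro continuous_intros)
    have "continuous_on (cbox (ln r, 0) (ln R, 2*pi))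
        (\<lambda>p::real\<times>real. deriv G (complex_of_real (exp (fst p)) * cis (snd p)))"
      using memU by (intro continuous_on_compose2[OF contG contE] image_subsetI)
    then show ?thesis
      unfolding F_def J_def by (intro continuous_on_power continuous_on_norm continuous_on_mult[OF contE])
  qed
  \<comment> \<open>The Jacobian integral in polar form: logarithm of the radius outside, angle
    inside, so that a bound on each circle can be integrated.\<close>
  define I where "I = integral {ln r..ln R} (\<lambda>t. integral {0..2*pi} (\<lambda>s. J (complex_of_real (exp t) * cis s)))"
  have "(F has_integral I) (cbox (ln r, 0) (ln R, 2*pi))"
    using integrable_integral[OF integrable_continuous[OF contF]] integral_prod_continuous[OF contF]
    by (simp add: I_def F_def)
  from has_integral_vec2_if_has_integral_prod[OF this]
  have "((\<lambda>x. J (exp (C x))) has_integral I) S"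
    by (simp add: S_def has_integral_open_interval F_def C_def exp_eq_polar)
  then have "((\<lambda>x. \<bar>det (matrix (\<Phi>' x))\<bar>) has_integral ((1 - (cmod \<kappa>)\<^sup>2) * I)) S"
    unfolding det by (rule has_integral_mult_right)
  moreover have "S \<in> sets lebesgue" by (simp add: S_def)
  ultimately have "\<Phi> ` S \<in> lmeasurable" "measure lebesgue (\<Phi> ` S) = (1 - (cmod \<kappa>)\<^sup>2) * I"
    using has_measure_differentiable_image[OF _ der inj] by blast+
  moreover have "\<Phi> ` S \<subseteq> cball 0 B"
    using bd bnds inU by (auto simp: \<Phi>_def normV T_def)
  then have "measure lebesgue (\<Phi> ` S) \<le> measure lebesgue (cball (0::real^2) B)"
    using calculation(1) by (intro measure_mono_fmeasurable) auto
  moreover have "measure lebesgue (cball (0::real^2) B) = pi * B\<^sup>2"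
    using B by (simp add: content_cball unit_ball_vol_2)
  moreover have "M \<le> I"
  proof (rule has_integral_le[OF m])
    show "((\<lambda>t. integral {0..2*pi} (\<lambda>s. J (complex_of_real (exp t) * cis s))) has_integral I) {ln r..ln R}"
      using integral_integrable_2dim[OF contF] by (auto simp: I_def F_def intro: integrable_integral)
    show "m t \<le> integral {0..2*pi} (\<lambda>s. J (complex_of_real (exp t) * cis s))" if "t \<in> {ln r..ln R}" for t
      using m_le[OF that] by (simp add: J_def)
  qed
  then have "(1 - (cmod \<kappa>)\<^sup>2) * M \<le> (1 - (cmod \<kappa>)\<^sup>2) * I"
    using \<kappa> by (intro mult_left_mono) (auto simp: power_le_one)
  ultimately show ?thesis by linarith
qed

text \<open>The factor \<open>- 1 / z\<^sup>2 + H z\<close> stands for the derivative of 1/z plus a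
  holomorphic function. This is Parseval's identity cut down to an inequality: after multiplication
  by z, the terms -1/z and H(0) z are orthogonal on the circle, and the remainder is orthogonal to
  both, so it can only increase the mean.\<close>

lemma circle_mean_square_lower_bound:
  fixes H :: "complex \<Rightarrow> complex"
  assumes H: "H holomorphic_on ball 0 1" and \<rho>: "0 < \<rho>" "\<rho> < 1"
  shows "2 * pi * (1 / \<rho>\<^sup>2 + (cmod (H 0))\<^sup>2 * \<rho>\<^sup>2)
    \<le> integral {0..2*pi} (\<lambda>s. (cmod (of_real \<rho> * cis s * (- 1 / (of_real \<rho> * cis s)\<^sup>2 + H (of_real \<rho> * cis s))))\<^sup>2)"
proof -
  define c where "c = H 0"
  \<comment> \<open>On the circle the cross terms of the square are the real part of the holomorphic function \<open>2 K\<close>,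
    which vanishes at 0 and so has mean zero.\<close>
  define K where "K = (\<lambda>z. - c * z\<^sup>2 / of_real (\<rho>\<^sup>2) - z\<^sup>2 * (H z - c) / of_real (\<rho>\<^sup>2) + cnj c * of_real (\<rho>\<^sup>2) * (H z - c))"
  define Z where "Z = (\<lambda>s. complex_of_real \<rho> * cis s)"
  have "K holomorphic_on ball 0 1"
    unfolding K_def using H \<rho> by (intro holomorphic_intros) auto
  then have "((\<lambda>s. K (Z s)) has_integral (2 * pi * K 0)) {0..2*pi}"
    using mean_value_circle \<rho> unfolding Z_def by blast
  then have "((\<lambda>s. Re (K (Z s))) has_integral 0) {0..2*pi}"
    by (auto dest: has_integral_Re simp: K_def c_def)
  from has_integral_add[OF has_integral_const_real[of "1 / \<rho>\<^sup>2 + (cmod c)\<^sup>2 * \<rho>\<^sup>2" 0 "2*pi"] has_integral_mult_right[OF this, of 2]]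
  have lhs: "((\<lambda>s. 1 / \<rho>\<^sup>2 + (cmod c)\<^sup>2 * \<rho>\<^sup>2 + 2 * Re (K (Z s))) has_integral
      2 * pi * (1 / \<rho>\<^sup>2 + (cmod c)\<^sup>2 * \<rho>\<^sup>2)) {0..2*pi}"
    by simp
  have Z: "Z s \<in> ball 0 1" "Z s \<noteq> 0" "cmod (Z s) = \<rho>" for s
    using \<rho> by (auto simp: Z_def norm_mult)
  have contZ: "continuous_on A Z" for A
    unfolding Z_def by (intro continuous_intros)
  have contHZ: "continuous_on A (\<lambda>s. H (Z s))" for A
    using Z by (intro continuous_on_compose2[OF holomorphic_on_imp_continuous_on[OF H] contZ]) auto
  have int: "(\<lambda>s. (cmod (Z s * (- 1 / (Z s)\<^sup>2 + H (Z s))))\<^sup>2) integrable_on {0..2*pi}"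
    using Z(2) by (intro integrable_continuous_real continuous_intros contZ contHZ) auto
  have le: "1 / \<rho>\<^sup>2 + (cmod c)\<^sup>2 * \<rho>\<^sup>2 + 2 * Re (K z) \<le> (cmod (z * (- 1 / z\<^sup>2 + H z)))\<^sup>2"
    if z: "z \<noteq> 0" "cmod z = \<rho>" for z
  proof -
    \<comment> \<open>\<open>p\<close> is the retained part -1/z + c z, with 1/z rewritten by means
      of |z| = \<open>\<rho>\<close>. The remainder is \<open>z * d\<close>, whose squared modulus
      is dropped.\<close>
    define p where "p = - cnj z / of_real (\<rho>\<^sup>2) + c * z"
    define d where "d = H z - c"
    have zc: "z * cnj z = of_real (\<rho>\<^sup>2)"
      using complex_norm_square[of z] z by simp
    have r0: "complex_of_real (\<rho>\<^sup>2) \<noteq> 0" using \<rho> by simp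
    have inv: "1 / z = cnj z / of_real (\<rho>\<^sup>2)"
      using zc r0 z by (simp add: field_simps)
    have "z * (- 1 / z\<^sup>2 + H z) = - (1 / z) + c * z + z * d"
      using z by (simp add: d_def field_simps power2_eq_square)
    then have eq: "z * (- 1 / z\<^sup>2 + H z) = p + z * d"
      unfolding inv p_def by simp
    have norm_add_sq: "(cmod (a + b))\<^sup>2 = (cmod a)\<^sup>2 + 2 * Re (cnj a * b) + (cmod b)\<^sup>2" for a b
      unfolding cmod_power2 by (simp add: power2_eq_square algebra_simps)
    have "(cmod (p + z * d))\<^sup>2 = (cmod p)\<^sup>2 + 2 * Re (cnj p * (z * d)) + (cmod (z * d))\<^sup>2"
      by (rule norm_add_sq)
    moreover have "cnj p * (z * d) = - z\<^sup>2 * d / of_real (\<rho>\<^sup>2) + cnj c * of_real (\<rho>\<^sup>2) * d"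
      unfolding p_def zc[symmetric] using z by (simp add: field_simps power2_eq_square)
    moreover have "(cmod p)\<^sup>2 = 1 / \<rho>\<^sup>2 + (cmod c)\<^sup>2 * \<rho>\<^sup>2 + 2 * Re (- c * z\<^sup>2 / of_real (\<rho>\<^sup>2))"
    proof -
      have "(cmod p)\<^sup>2 = (cmod (- cnj z / of_real (\<rho>\<^sup>2)))\<^sup>2 + (cmod (c * z))\<^sup>2 + 2 * Re (cnj (- cnj z / of_real (\<rho>\<^sup>2)) * (c * z))"
        unfolding p_def by (subst norm_add_sq) simp
      also have "cnj (- cnj z / of_real (\<rho>\<^sup>2)) * (c * z) = - c * z\<^sup>2 / of_real (\<rho>\<^sup>2)"
        by (simp add: power2_eq_square)
      also have "(cmod (- cnj z / of_real (\<rho>\<^sup>2)))\<^sup>2 = 1 / \<rho>\<^sup>2"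
        using \<rho> z by (simp add: norm_divide norm_power power2_eq_square norm_mult)
      finally show ?thesis using z by (simp add: norm_mult power_mult_distrib)
    qed
    moreover have "K z = - c * z\<^sup>2 / of_real (\<rho>\<^sup>2) + (- z\<^sup>2 * d / of_real (\<rho>\<^sup>2) + cnj c * of_real (\<rho>\<^sup>2) * d)"
      by (simp add: K_def d_def)
    ultimately show ?thesis
      unfolding eq by simp
  qed
  have "2 * pi * (1 / \<rho>\<^sup>2 + (cmod c)\<^sup>2 * \<rho>\<^sup>2)
      \<le> integral {0..2*pi} (\<lambda>s. (cmod (Z s * (- 1 / (Z s)\<^sup>2 + H (Z s))))\<^sup>2)"
    using Z le by (intro has_integral_le[OF lhs integrable_integral[OF int]]) auto
  then show ?thesis
    unfolding c_def Z_def .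
qed

text \<open>Only continuity is assumed, because the map in question is not holomorphic after
  composition with \<open>w - \<kappa> * cnj w\<close>. The image of the punctured disc of radius
  \<open>r\<close> is open and reaches infinity. If \<open>F z1\<close> lay beyond the disc of
  radius \<open>B\<close>, the connected exterior of that disc would meet the frontier of this
  image. Such a frontier point is a limit of values at points tending to some \<open>l\<close>: the
  case \<open>l = 0\<close> is excluded by the pole, |l| < r by openness, and |l| = r by the bound
  on the circle.\<close>

lemma image_outside_enclosed:
  fixes F :: "complex \<Rightarrow> complex"
  assumes cont: "continuous_on (ball 0 1 - {0}) F" and inj: "inj_on F (ball 0 1 - {0})"
    and lim: "filterlim F at_infinity (at 0)"
    and r: "0 < r" "r < 1" and bd: "\<And>z. cmod z = r \<Longrightarrow> cmod (F z) \<le> B"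
    and z1: "r < cmod z1" "cmod z1 < 1"
  shows "cmod (F z1) \<le> B"
proof (rule ccontr)
  assume gt: "\<not> cmod (F z1) \<le> B"
  define D where "D = ball (0::complex) r - {0}"
  have D: "D \<subseteq> ball 0 1 - {0}" "open D" using r by (auto simp: D_def)
  have openS: "open (F ` D)"
    using D by (intro invariance_of_domain continuous_on_subset[OF cont] inj_on_subset[OF inj])
  have "F z1 \<notin> F ` D"
    using z1 r by (subst inj_on_image_mem_iff[OF inj]) (auto simp: D_def)
  with gt have ne1: "- cball 0 B - F ` D \<noteq> {}" by (auto simp: D_def)
  have "eventually (\<lambda>z. B < cmod (F z)) (at 0)"
    using filterlim_at_infinity_imp_norm_at_top[OF lim] by (simp add: filterlim_at_top_dense)
  moreover have "eventually (\<lambda>z. z \<in> D) (at 0)"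
    unfolding D_def using r by (intro eventually_at_in_open) auto
  ultimately have "eventually (\<lambda>z. B < cmod (F z) \<and> z \<in> D) (at 0)"
    by eventually_elim auto
  then obtain z0 where "B < cmod (F z0)" "z0 \<in> D"
    using eventually_happens'[of "at (0::complex)"] by auto
  then have ne2: "- cball 0 B \<inter> F ` D \<noteq> {}" by (force simp: not_le)
  have "connected (- cball (0::complex) B)"
    by (intro connected_complement_bounded_convex) auto
  from connected_Int_frontier[OF this ne2 ne1] obtain w where
    w: "B < cmod w" "w \<in> closure (F ` D)" "w \<notin> F ` D"
    using openS by (auto simp: frontier_def interior_open not_le)
  from w(2) obtain x where "\<And>n. x n \<in> F ` D" and x: "x \<longlonglongrightarrow> w"
    by (auto simp: closure_sequential)
  then have "\<forall>n. \<exists>y. y \<in> D \<and> x n = F y" by blast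
  then obtain z where z: "\<And>n. z n \<in> D" "\<And>n. x n = F (z n)"
    by metis
  have "\<forall>n. z n \<in> cball 0 r" using z(1) by (auto simp: D_def less_imp_le)
  then obtain l q where l: "l \<in> cball 0 r" and q: "strict_mono (q::nat\<Rightarrow>nat)" and zl: "(z \<circ> q) \<longlonglongrightarrow> l"
    using compact_cball[of "0::complex" r] unfolding compact_def by metis
  have Fw: "(\<lambda>n. F ((z \<circ> q) n)) \<longlonglongrightarrow> w"
    using LIMSEQ_subseq_LIMSEQ[OF x q] z(2) by (simp add: o_def)
  have "l \<noteq> 0"
  proof
    assume "l = 0"
    have nz: "\<And>n. (z \<circ> q) n \<noteq> 0" using z(1) by (auto simp: D_def)
    have "filterlim (z \<circ> q) (at 0) sequentially"
      using zl nz \<open>l = 0\<close> by (auto simp: filterlim_at)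
    then have "filterlim (\<lambda>n. F ((z \<circ> q) n)) at_infinity sequentially"
      by (rule filterlim_compose[OF lim])
    with Fw show False
      using not_tendsto_and_filterlim_at_infinity[of sequentially] by auto
  qed
  with l r have lb: "l \<in> ball 0 1 - {0}" by auto
  then have "isCont F l"
    using cont by (auto simp: continuous_on_eq_continuous_at open_delete)
  then have "(\<lambda>n. F ((z \<circ> q) n)) \<longlonglongrightarrow> F l"
    using zl isCont_tendsto_compose by blast
  then have wl: "w = F l" using Fw LIMSEQ_unique by blast
  show False
  proof (cases "cmod l = r")
    case True then show ?thesis using bd wl w(1) by force
  next
    case False then show ?thesis using wl w(3) l \<open>l \<noteq> 0\<close> by (auto simp: D_def)
  qed
qed

text \<open>The quotient is redefined only at 0, so the factorisation holds for every complex
  \<open>z\<close>, including points outside the disc.\<close>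

lemma holomorphic_divided_difference_at_0:
  fixes f :: "complex \<Rightarrow> complex"
  assumes f: "f holomorphic_on ball 0 1"
  obtains g where "g holomorphic_on ball 0 1" "\<And>z. f z = f 0 + z * g z" "g 0 = deriv f 0"
proof
  show "(\<lambda>z. if z = 0 then deriv f 0 else (f z - f 0) / (z - 0)) holomorphic_on ball 0 1"
    by (rule pole_lemma[OF f]) auto
qed auto

text \<open>The first-coefficient case of Gronwall's area inequality.\<close>

theorem area_theorem_first_coeff:
  fixes \<phi> :: "complex \<Rightarrow> complex"
  assumes \<phi>: "\<phi> holomorphic_on ball 0 1"
    and inj: "inj_on (\<lambda>z. 1 / z + \<phi> z) (ball 0 1 - {0})"
  shows "cmod (deriv \<phi> 0) \<le> 1"
proof -
  define c where "c = deriv \<phi> 0"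
  \<comment> \<open>Translation by \<open>\<phi> 0\<close> affects neither injectivity nor the
    derivative, and it makes c z the first term after the pole.\<close>
  define G where "G = (\<lambda>z. 1 / z + (\<phi> z - \<phi> 0))"
  define U where "U = ball (0::complex) 1 - {0}"
  have U: "open U" by (auto simp: U_def open_delete)
  have holG: "G holomorphic_on U"
    unfolding G_def U_def by (intro holomorphic_intros holomorphic_on_subset[OF \<phi>]) auto
  have injG: "inj_on G U"
    using inj unfolding inj_on_def G_def U_def by auto
  have derG: "deriv G z = - 1 / z\<^sup>2 + deriv \<phi> z" if "z \<in> U" for z
  proof (rule DERIV_imp_deriv)
    have "(\<phi> has_field_derivative deriv \<phi> z) (at z)"
      using \<phi> that by (intro holomorphic_derivI[of _ "ball 0 1"]) (auto simp: U_def)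
    then show "(G has_field_derivative - 1 / z\<^sup>2 + deriv \<phi> z) (at z)"
      unfolding G_def using that
      by (auto intro!: derivative_eq_intros simp: U_def power2_eq_square divide_inverse)
  qed
  obtain \<phi>1 where \<phi>1: "\<phi>1 holomorphic_on ball 0 1" "\<And>z. \<phi> z = \<phi> 0 + z * \<phi>1 z" "\<phi>1 0 = c"
    unfolding c_def using holomorphic_divided_difference_at_0[OF \<phi>] by metis
  obtain \<phi>2 where \<phi>2: "\<phi>2 holomorphic_on ball 0 1" "\<And>z. \<phi>1 z = c + z * \<phi>2 z"
    using holomorphic_divided_difference_at_0[OF \<phi>1(1)] \<phi>1(3) by metis
  have "compact (\<phi>2 ` cball 0 (1/2))"
    by (intro compact_continuous_image holomorphic_on_imp_continuous_on holomorphic_on_subset[OF \<phi>2(1)]) auto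
  then obtain M where M: "M > 0" "\<And>z. cmod z \<le> 1/2 \<Longrightarrow> cmod (\<phi>2 z) \<le> M"
    using compact_imp_bounded[of "\<phi>2 ` cball 0 (1/2)"] by (auto simp: bounded_pos)
  have Geq: "G z = 1 / z + c * z + z\<^sup>2 * \<phi>2 z" for z
    unfolding G_def \<phi>1(2)[of z] \<phi>2(2)[of z] by (simp add: algebra_simps power2_eq_square)
  \<comment> \<open>Collects the error terms of order \<open>r\<^sup>2\<close> on the circle:
    \<open>M\<close> from \<open>z\<^sup>2 * \<phi>2 z\<close>, and |c| (|c| + M) from the
    conjugated term.\<close>
  define C where "C = M + (cmod c)\<^sup>2 + cmod c * M"
  have C: "C \<ge> 0" using M by (simp add: C_def)
  \<comment> \<open>The condition \<open>r < 1/2\<close> keeps the circle where \<open>M\<close>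
    bounds \<open>\<phi>2\<close>, \<open>cmod c * r\<^sup>2 < 1\<close> makes
    |\<open>\<kappa>\<close>| < 1, and \<open>1/2 < R\<close> ensures r < R.\<close>
  have ineq: "(1 - (cmod c)\<^sup>2 * r^4) * (1 / r\<^sup>2 - 1 / R\<^sup>2 + (cmod c)\<^sup>2 * (R\<^sup>2 - r\<^sup>2)) \<le> (1 / r + C * r\<^sup>2)\<^sup>2"
    if r: "0 < r" "r < 1/2" "cmod c * r\<^sup>2 < 1" and R: "1/2 < R" "R < 1" for r R :: real
  proof -
    \<comment> \<open>On \<open>|z| = r\<close> we have \<open>\<kappa> cnj (1/z) = c z\<close>, so \<open>w - \<kappa> cnj w\<close> maps the near-ellipse \<open>G z\<close> to a
      circle up to an error of order \<open>r\<^sup>2\<close>, which does not contribute to the area as \<open>r \<rightarrow> 0\<close>.\<close>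
    define \<kappa> where "\<kappa> = c * of_real (r\<^sup>2)"
    have \<kappa>: "cmod \<kappa> = cmod c * r\<^sup>2" by (simp add: \<kappa>_def norm_mult norm_power)
    define F where "F = (\<lambda>z. G z - \<kappa> * cnj (G z))"
    define B where "B = 1 / r + C * r\<^sup>2"
    have B: "B \<ge> 0" using r C by (simp add: B_def)
    have bd: "cmod (F z) \<le> B" if z: "cmod z = r" for z
    proof -
      have "z \<noteq> 0" using z r by auto
      have zc: "of_real (r\<^sup>2) = z * cnj z" using complex_norm_square[of z] z by simp
      have "\<kappa> * cnj (1 / z) = c * z"
        using \<open>z \<noteq> 0\<close> unfolding \<kappa>_def zc by simp
      then have "F z = 1 / z + z\<^sup>2 * \<phi>2 z - \<kappa> * cnj (c * z + z\<^sup>2 * \<phi>2 z)"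
        unfolding F_def Geq by (simp add: algebra_simps)
      also have "cmod \<dots> \<le> cmod (1 / z) + cmod (z\<^sup>2 * \<phi>2 z) + cmod (\<kappa> * cnj (c * z + z\<^sup>2 * \<phi>2 z))"
        by (meson add_mono norm_triangle_ineq norm_triangle_ineq4 order_refl order_trans)
      also have "\<dots> \<le> 1 / r + M * r\<^sup>2 + (cmod c * r\<^sup>2) * (cmod c + M)"
      proof (intro add_mono)
        have m: "cmod (\<phi>2 z) \<le> M" using M(2)[of z] z r by simp
        then show s: "cmod (z\<^sup>2 * \<phi>2 z) \<le> M * r\<^sup>2"
          using z by (simp add: norm_mult norm_power mult.commute mult_right_mono)
        have "cmod (c * z + z\<^sup>2 * \<phi>2 z) \<le> cmod (c * z) + cmod (z\<^sup>2 * \<phi>2 z)"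
          by (rule norm_triangle_ineq)
        also have "\<dots> \<le> cmod c * 1 + M * 1"
        proof (intro add_mono)
          show "cmod (c * z) \<le> cmod c * 1" using z r by (simp add: norm_mult mult_left_le)
          have "M * r\<^sup>2 \<le> M * 1" using M r by (intro mult_left_mono) (auto simp: power_le_one)
          then show "cmod (z\<^sup>2 * \<phi>2 z) \<le> M * 1" using s by linarith
        qed
        finally have "cmod (cnj (c * z + z\<^sup>2 * \<phi>2 z)) \<le> cmod c + M"
          unfolding complex_mod_cnj by simp
        then show "cmod (\<kappa> * cnj (c * z + z\<^sup>2 * \<phi>2 z)) \<le> (cmod c * r\<^sup>2) * (cmod c + M)"
          unfolding norm_mult \<kappa> by (intro mult_left_mono) auto
        show "cmod (1 / z) \<le> 1 / r" using z by (simp add: norm_divide)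
      qed
      also have "\<dots> = B" by (simp add: B_def C_def algebra_simps power2_eq_square)
      finally show ?thesis .
    qed
    have Fge: "(1 - cmod \<kappa>) * cmod (G z) \<le> cmod (F z)" for z
      using norm_triangle_ineq2[of "G z" "\<kappa> * cnj (G z)"] by (simp add: F_def norm_mult algebra_simps)
    have \<kappa>1: "cmod \<kappa> < 1" using r by (simp add: \<kappa>)
    have limG: "filterlim G at_infinity (at 0)"
    proof -
      have "(\<phi> \<longlongrightarrow> \<phi> 0) (at 0)"
        using \<phi> by (metis centre_in_ball continuous_on_interior holomorphic_on_imp_continuous_on
            interior_ball isCont_def zero_less_one)
      then have "((\<lambda>z. \<phi> z - \<phi> 0) \<longlongrightarrow> 0) (at 0)"
        by (simp add: LIM_zero)
      moreover have "filterlim (\<lambda>z::complex. 1 / z) at_infinity (at 0)"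
        using filterlim_inverse_at_infinity by (simp add: divide_inverse)
      ultimately show ?thesis
        unfolding G_def using tendsto_add_filterlim_at_infinity' by blast
    qed
    have limF: "filterlim F at_infinity (at 0)"
    proof (rule filterlim_norm_at_top_imp_at_infinity)
      have "filterlim (\<lambda>z. (1 - cmod \<kappa>) * cmod (G z)) at_top (at 0)"
        using \<kappa>1 filterlim_at_infinity_imp_norm_at_top[OF limG]
        by (intro filterlim_tendsto_pos_mult_at_top[OF tendsto_const]) auto
      then show "filterlim (\<lambda>z. cmod (F z)) at_top (at 0)"
        by (rule filterlim_at_top_mono) (simp add: Fge)
    qed
    have contF: "continuous_on U F"
      unfolding F_def using holomorphic_on_imp_continuous_on[OF holG] by (intro continuous_intros)
    have injF: "inj_on F U"
    proof (rule inj_onI)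
      fix x y assume xy: "x \<in> U" "y \<in> U" "F x = F y"
      then have "G x - G y = \<kappa> * cnj (G x - G y)" by (simp add: F_def algebra_simps)
      then have "cmod (G x - G y) = cmod \<kappa> * cmod (G x - G y)"
        by (metis complex_mod_cnj norm_mult)
      with \<kappa>1 have "G x = G y" by auto
      with xy injG show "x = y" by (auto dest: inj_onD)
    qed
    have out: "cmod (G z - \<kappa> * cnj (G z)) \<le> B" if "r < cmod z" "cmod z < 1" for z
      using image_outside_enclosed[OF contF[unfolded U_def] injF[unfolded U_def] limF _ _ bd that] r
      by (simp add: F_def)
    \<comment> \<open>In the variable t, the logarithm of the radius, \<open>m\<close> is the lower
      bound on each circle and \<open>N\<close> is an antiderivative of it.\<close>
    define m where "m = (\<lambda>t. 2 * pi * (1 / (exp t)\<^sup>2 + (cmod c)\<^sup>2 * (exp t)\<^sup>2))"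
    define N where "N = (\<lambda>t. pi * ((cmod c)\<^sup>2 * (exp t)\<^sup>2 - 1 / (exp t)\<^sup>2) :: real)"
    have rR: "ln r \<le> ln R" using r R by simp
    have "(m has_integral (N (ln R) - N (ln r))) {ln r..ln R}"
    proof (rule fundamental_theorem_of_calculus[OF rR])
      fix t :: real
      have "(N has_field_derivative m t) (at t within {ln r..ln R})"
        unfolding N_def m_def by (auto intro!: derivative_eq_intros simp: field_simps power2_eq_square)
      then show "(N has_vector_derivative m t) (at t within {ln r..ln R})"
        by (simp add: has_real_derivative_iff_has_vector_derivative)
    qed
    moreover have "m t \<le> integral {0..2*pi} (\<lambda>s. (cmod (of_real (exp t) * cis s * deriv G (of_real (exp t) * cis s)))\<^sup>2)"
      if t: "t \<in> {ln r..ln R}" for t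
    proof -
      have "exp t \<le> R" using t r R by (metis atLeastAtMost_iff exp_le_cancel_iff exp_ln less_trans zero_less_divide_1_iff zero_less_numeral)
      then have e: "exp t < 1" using R by linarith
      have "of_real (exp t) * cis s \<in> U" for s
        using e by (auto simp: U_def norm_mult)
      then show ?thesis
        using circle_mean_square_lower_bound[OF holomorphic_deriv[OF \<phi>] _ e]
        by (simp add: derG m_def c_def)
    qed
    ultimately have "(1 - (cmod \<kappa>)\<^sup>2) * (N (ln R) - N (ln r)) \<le> pi * B\<^sup>2"
      using r R B \<kappa>1 out by (intro area_image_lower_bound[OF U holG injG, where r = r and R = R and m = m]) (auto simp: U_def)
    moreover have "N (ln R) - N (ln r) = pi * (1 / r\<^sup>2 - 1 / R\<^sup>2 + (cmod c)\<^sup>2 * (R\<^sup>2 - r\<^sup>2))"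
      using r R by (simp add: N_def algebra_simps)
    moreover have "(cmod \<kappa>)\<^sup>2 = (cmod c)\<^sup>2 * r^4"
      by (simp add: \<kappa> power_mult_distrib flip: power_mult)
    ultimately have "pi * ((1 - (cmod c)\<^sup>2 * r^4) * (1 / r\<^sup>2 - 1 / R\<^sup>2 + (cmod c)\<^sup>2 * (R\<^sup>2 - r\<^sup>2))) \<le> pi * B\<^sup>2"
      by (simp add: mult_ac)
    then show ?thesis
      unfolding B_def by (subst (asm) mult_le_cancel_left_pos) auto
  qed
  have cR: "cmod c * R\<^sup>2 \<le> 1" if R: "1/2 < R" "R < 1" for R :: real
  proof -
    define A where "A = (cmod c)\<^sup>2"
    \<comment> \<open>Left side minus right side of \<open>ineq\<close>, expanded so that the
      singular terms 1/r^2 cancel. The result is continuous at r = 0, and its value there gives the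
      limiting inequality.\<close>
    define f where "f = (\<lambda>r. - 1 / R\<^sup>2 + A * (R\<^sup>2 - r\<^sup>2) - A * r\<^sup>2
       - A * r^4 * (- 1 / R\<^sup>2 + A * (R\<^sup>2 - r\<^sup>2)) - 2 * C * r - C\<^sup>2 * r^4)"
    have "isCont f 0" unfolding f_def by (intro continuous_intros) (use R in auto)
    then have "(f \<longlongrightarrow> f 0) (at_right 0)"
      by (simp add: isCont_def filterlim_at_split)
    moreover have "eventually (\<lambda>r. f r \<le> 0) (at_right 0)"
    proof -
      have "((\<lambda>r::real. cmod c * r\<^sup>2) \<longlongrightarrow> cmod c * 0\<^sup>2) (at_right 0)"
        by (intro tendsto_intros)
      then have "eventually (\<lambda>r::real. cmod c * r\<^sup>2 < 1) (at_right 0)"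
        by (rule order_tendstoD) simp
      moreover have "eventually (\<lambda>r::real. r \<in> {0<..<1/2}) (at_right 0)"
        by (intro eventually_at_right_real) simp
      ultimately show ?thesis
      proof eventually_elim
        case (elim r)
        then have r0: "r \<noteq> 0" by auto
        have "f r = (1 - A * r^4) * (1 / r\<^sup>2 - 1 / R\<^sup>2 + A * (R\<^sup>2 - r\<^sup>2)) - (1 / r + C * r\<^sup>2)\<^sup>2"
          unfolding f_def using r0 R by (simp add: field_simps power2_eq_square power4_eq_xxxx)
        also have "\<dots> \<le> 0" using ineq[of r R] elim R by (simp add: A_def)
        finally show ?case .
      qed
    qed
    ultimately have "f 0 \<le> 0"
      by (rule tendsto_upperbound) simp
    then have "A * R\<^sup>2 \<le> 1 / R\<^sup>2" by (simp add: f_def)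
    then have "(cmod c * R\<^sup>2)\<^sup>2 \<le> 1\<^sup>2"
      using R by (simp add: A_def field_simps power2_eq_square)
    then show ?thesis by (rule power2_le_imp_le) simp
  qed
  have "((\<lambda>R. cmod c * R\<^sup>2) \<longlongrightarrow> cmod c * 1\<^sup>2) (at_left 1)"
    by (intro tendsto_intros)
  moreover have "eventually (\<lambda>R. cmod c * R\<^sup>2 \<le> 1) (at_left (1::real))"
    by (rule eventually_mono[OF eventually_at_left_real[of "1/2" 1]]) (auto intro: cR)
  ultimately have "cmod c * 1\<^sup>2 \<le> 1"
    by (rule tendsto_upperbound) simp
  then show ?thesis by (simp add: c_def)
qed

section \<open>Bieberbach's inequality and the pre-Schwarzian derivative\<close>

text \<open>As f''(0) = 2 a2, this is |a2| <= 2. Write f(z) = z k(z) with k free of zeros and let p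
  be the square root of 1/k with p(0) = 1. Then p(z^2)/z = 1/z + \<open>\<phi> z\<close> is
  injective, and its linear coefficient is p'(0) = -k'(0)/2 = -a2/2, which the area theorem bounds
  by 1.\<close>

theorem bieberbach_second_coeff:
  fixes f :: "complex \<Rightarrow> complex"
  assumes f: "f holomorphic_on ball 0 1" and inj: "inj_on f (ball 0 1)"
    and f0: "f 0 = 0" and f'0: "deriv f 0 = 1"
  shows "cmod (deriv (deriv f) 0) \<le> 4"
proof -
  obtain k where k: "k holomorphic_on ball 0 1" and fk: "\<And>z. f z = z * k z" and k0: "k 0 = 1"
    using holomorphic_divided_difference_at_0[OF f] f0 f'0 by (metis add_0)
  have knz: "k z \<noteq> 0" if "z \<in> ball 0 1" for z
  proof (cases "z = 0")
    case False
    then have "f z \<noteq> f 0" using inj_onD[OF inj, of z 0] that by auto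
    then show ?thesis using fk f0 by auto
  qed (simp add: k0)
  obtain s where s: "s holomorphic_on ball 0 1" and ks: "\<And>z. z \<in> ball 0 1 \<Longrightarrow> k z = s z ^ 2"
    using contractible_imp_holomorphic_sqrt[OF k convex_imp_contractible[OF convex_ball] knz] by metis
  have snz: "s z \<noteq> 0" if "z \<in> ball 0 1" for z
    using knz[OF that] ks[OF that] by auto
  \<comment> \<open>Dividing \<open>s 0\<close> by \<open>s\<close> removes the sign ambiguity of
    the square root, since \<open>s 0\<close> is 1 or -1.\<close>
  define p where "p = (\<lambda>z. s 0 / s z)"
  have p: "p holomorphic_on ball 0 1"
    unfolding p_def using snz s by (intro holomorphic_intros) auto
  have p0: "p 0 = 1" using snz[of 0] by (simp add: p_def)
  have pk: "(p z)\<^sup>2 * k z = 1" if "z \<in> ball 0 1" for z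
    using ks[OF that] ks[of 0] k0 snz[OF that] by (simp add: p_def power_divide)
  obtain q where q: "q holomorphic_on ball 0 1" and pq: "\<And>z. p z = 1 + z * q z" and q0: "q 0 = deriv p 0"
    using holomorphic_divided_difference_at_0[OF p] p0 by metis
  \<comment> \<open>\<open>1 / z + \<phi> z\<close> is the reciprocal of the square-root transform \<open>sqrt (f (z\<^sup>2))\<close>, normalised at 0.\<close>
  define \<phi> where "\<phi> = (\<lambda>z. z * q (z\<^sup>2))"
  have sq: "z\<^sup>2 \<in> ball 0 1" if "z \<in> ball 0 1" for z :: complex
    using that by (simp add: norm_power power_less_one_iff)
  have hq: "(\<lambda>z. q (z\<^sup>2)) holomorphic_on ball 0 1"
    using holomorphic_on_compose_gen[of "\<lambda>z. z\<^sup>2" "ball 0 1" q "ball 0 1", OF _ q] sq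
    by (simp add: o_def image_subset_iff holomorphic_on_power)
  have \<phi>: "\<phi> holomorphic_on ball 0 1"
    unfolding \<phi>_def by (intro holomorphic_intros hq)
  have Geq: "1 / z + \<phi> z = p (z\<^sup>2) / z" if "z \<noteq> 0" for z
    using that by (simp add: \<phi>_def pq field_simps power2_eq_square)
  have "inj_on (\<lambda>z. 1 / z + \<phi> z) (ball 0 1 - {0})"
  proof (rule inj_onI)
    fix z w assume zw: "z \<in> ball 0 1 - {0}" "w \<in> ball 0 1 - {0}" "1 / z + \<phi> z = 1 / w + \<phi> w"
    then have eq: "p (z\<^sup>2) / z = p (w\<^sup>2) / w" by (simp add: Geq)
    \<comment> \<open>This identity turns equal values at z and w into z^2 = w^2. The equality of
      p(z^2)/z and p(w^2)/w, with p(z^2) nonzero, then excludes w = -z.\<close>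
    have inv: "(p (z\<^sup>2) / z)\<^sup>2 * f (z\<^sup>2) = 1" if "z \<in> ball 0 1 - {0}" for z
      using pk[of "z\<^sup>2"] sq[of z] that by (simp add: fk power_divide)
    have "f (z\<^sup>2) = f (w\<^sup>2)"
      using inv[OF zw(1)] inv[OF zw(2)] unfolding eq by (metis mult_cancel_left mult_zero_left zero_neq_one)
    then have "z\<^sup>2 = w\<^sup>2" using inj_onD[OF inj] sq zw by auto
    moreover have "p (z\<^sup>2) \<noteq> 0" using inv[OF zw(1)] by auto
    ultimately show "z = w" using eq zw by (simp add: field_simps)
  qed
  from area_theorem_first_coeff[OF \<phi> this] have "cmod (deriv \<phi> 0) \<le> 1" .
  moreover have "deriv \<phi> 0 = deriv p 0"
  proof (rule DERIV_imp_deriv)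
    have "((\<lambda>z. q (z\<^sup>2)) has_field_derivative deriv (\<lambda>z. q (z\<^sup>2)) 0) (at 0)"
      by (rule holomorphic_derivI[OF hq]) auto
    then show "(\<phi> has_field_derivative deriv p 0) (at 0)"
      unfolding \<phi>_def by (auto intro!: derivative_eq_intros simp: q0)
  qed
  moreover have "2 * deriv p 0 + deriv k 0 = 0"
  proof -
    have "(p has_field_derivative deriv p 0) (at 0)" "(k has_field_derivative deriv k 0) (at 0)"
      by (rule holomorphic_derivI[OF p] holomorphic_derivI[OF k]; simp)+
    then have "((\<lambda>z. (p z)\<^sup>2 * k z) has_field_derivative 2 * deriv p 0 + deriv k 0) (at 0)"
      by (auto intro!: derivative_eq_intros simp: p0 k0)
    moreover have "((\<lambda>z. (p z)\<^sup>2 * k z) has_field_derivative 0) (at 0)"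
      by (rule has_field_derivative_transform_within_open[of "\<lambda>_. 1" _ _ "ball 0 1"]) (auto simp: pk)
    ultimately show ?thesis by (rule DERIV_unique)
  qed
  moreover have "deriv (deriv f) 0 = 2 * deriv k 0"
  proof (rule DERIV_imp_deriv)
    have k1: "(k has_field_derivative deriv k z) (at z)" if "z \<in> ball 0 1" for z
      using that by (intro holomorphic_derivI[OF k]) auto
    have f1: "deriv f z = k z + z * deriv k z" if "z \<in> ball 0 1" for z
    proof (rule DERIV_imp_deriv)
      have "((\<lambda>z. z * k z) has_field_derivative k z + z * deriv k z) (at z)"
        using k1[OF that] by (auto intro!: derivative_eq_intros)
      then show "(f has_field_derivative k z + z * deriv k z) (at z)"
        using fk by presburger
    qed
    have "(deriv k has_field_derivative deriv (deriv k) 0) (at 0)"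
      by (rule holomorphic_derivI[OF holomorphic_deriv[OF k]]) auto
    then have "((\<lambda>z. k z + z * deriv k z) has_field_derivative 2 * deriv k 0) (at 0)"
      using k1[of 0] by (auto intro!: derivative_eq_intros)
    then show "(deriv f has_field_derivative 2 * deriv k 0) (at 0)"
      by (rule has_field_derivative_transform_within_open[of _ _ _ "ball 0 1"]) (auto simp: f1)
  qed
  ultimately have "deriv (deriv f) 0 = - 4 * deriv \<phi> 0" "cmod (deriv \<phi> 0) \<le> 1"
    by (auto simp: algebra_simps add_eq_0_iff)
  then show ?thesis by (simp add: norm_mult)
qed

text \<open>The quantity inside the modulus is the second derivative at 0 of the Koebe transform,
  the normalised composition of \<open>f\<close> with the disc automorphism taking 0 to
  \<open>a\<close>.\<close>

theorem univalent_pre_schwarzian_bound: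
  fixes f :: "complex \<Rightarrow> complex"
  assumes f: "f holomorphic_on ball 0 1" and inj: "inj_on f (ball 0 1)" and a: "cmod a < 1"
  shows "cmod ((1 - (cmod a)\<^sup>2) * deriv (deriv f) a / deriv f a - 2 * cnj a) \<le> 4"
proof -
  define \<delta> where "\<delta> = complex_of_real (1 - (cmod a)\<^sup>2)"
  have "(cmod a)\<^sup>2 < 1" using a by (simp add: power_less_one_iff)
  then have \<delta>: "\<delta> \<noteq> 0" by (simp add: \<delta>_def complex_eq_iff)
  have \<delta>a: "\<delta> = 1 - a * cnj a" by (simp add: \<delta>_def complex_norm_square[symmetric])
  define \<mu> where "\<mu> = (\<lambda>z. (z + a) / (1 + cnj a * z))"
  have \<mu>M: "\<mu> = Moebius_function 0 (- a)"
    by (simp add: \<mu>_def Moebius_function_def fun_eq_iff)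
  have \<mu>ball: "\<mu> z \<in> ball 0 1" if "z \<in> ball 0 1" for z
    using that a Moebius_function_norm_lt_1[of "- a" z 0] by (simp add: \<mu>M)
  have den: "1 + cnj a * z \<noteq> 0" if "z \<in> ball 0 1" for z
  proof
    assume "1 + cnj a * z = 0"
    then have "cnj a * z = - 1" by (metis add_eq_0_iff)
    then have "cmod a * cmod z = 1" by (metis complex_mod_cnj norm_minus_cancel norm_mult norm_one)
    moreover have "cmod a * cmod z < 1" using a that mult_strict_mono[of "cmod a" 1 "cmod z" 1] by simp
    ultimately show False by simp
  qed
  have inj\<mu>: "inj_on \<mu> (ball 0 1)"
    by (rule inj_on_inverseI[where g = "Moebius_function 0 a"])
      (use a in \<open>auto simp: \<mu>M intro!: Moebius_function_compose\<close>)
  have fd: "(f has_field_derivative deriv f z) (at z)" if "z \<in> ball 0 1" for z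
    using that by (intro holomorphic_derivI[OF f]) auto
  have fd2: "(deriv f has_field_derivative deriv (deriv f) z) (at z)" if "z \<in> ball 0 1" for z
    using that by (intro holomorphic_derivI[OF holomorphic_deriv[OF f]]) auto
  have f'a: "deriv f a \<noteq> 0"
    using holomorphic_injective_imp_regular[OF f _ inj] a by simp
  have \<mu>d: "(\<mu> has_field_derivative \<delta> / (1 + cnj a * z)\<^sup>2) (at z)" if "z \<in> ball 0 1" for z
    unfolding \<mu>_def using den[OF that]
    by (auto intro!: derivative_eq_intros simp: power2_eq_square \<delta>a algebra_simps)
  \<comment> \<open>the Koebe transform of \<open>f\<close> at \<open>a\<close>\<close>
  define F where "F = (\<lambda>z. (f (\<mu> z) - f a) / (\<delta> * deriv f a))"
  have Fd: "(F has_field_derivative deriv f (\<mu> z) / (deriv f a * (1 + cnj a * z)\<^sup>2)) (at z)"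
    if "z \<in> ball 0 1" for z
    unfolding F_def using DERIV_chain2[OF fd[OF \<mu>ball[OF that]] \<mu>d[OF that]] \<delta> f'a
    by (auto intro!: derivative_eq_intros)
  have F': "deriv F z = deriv f (\<mu> z) / (deriv f a * (1 + cnj a * z)\<^sup>2)" if "z \<in> ball 0 1" for z
    using Fd[OF that] by (rule DERIV_imp_deriv)
  have holF: "F holomorphic_on ball 0 1"
    using Fd by (meson holomorphic_onI field_differentiable_at_within field_differentiable_def)
  have \<mu>0: "\<mu> 0 = a" by (simp add: \<mu>_def)
  have injF: "inj_on F (ball 0 1)"
  proof (rule inj_onI)
    fix z w assume "z \<in> ball 0 1" "w \<in> ball 0 1" "F z = F w"
    moreover from this have "f (\<mu> z) = f (\<mu> w)" using \<delta> f'a by (simp add: F_def)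
    ultimately show "z = w"
      using \<mu>ball inj_onD[OF inj] inj_onD[OF inj\<mu>] by blast
  qed
  have "cmod (deriv (deriv F) 0) \<le> 4"
    by (rule bieberbach_second_coeff[OF holF injF]) (use f'a in \<open>auto simp: F' \<mu>0\<close>, simp add: F_def \<mu>0)
  moreover have "deriv (deriv F) 0 = \<delta> * deriv (deriv f) a / deriv f a - 2 * cnj a"
  proof (rule DERIV_imp_deriv)
    have z0: "(0::complex) \<in> ball 0 1" by simp
    have "((\<lambda>z. deriv f (\<mu> z)) has_field_derivative deriv (deriv f) (\<mu> 0) * (\<delta> / (1 + cnj a * 0)\<^sup>2)) (at 0)"
      by (rule DERIV_chain2[OF fd2[OF \<mu>ball[OF z0]] \<mu>d[OF z0]])
    then have d1: "((\<lambda>z. deriv f (\<mu> z)) has_field_derivative deriv (deriv f) a * \<delta>) (at 0)"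
      by (simp add: \<mu>0)
    have "((\<lambda>z. deriv f (\<mu> z) / (deriv f a * (1 + cnj a * z)\<^sup>2)) has_field_derivative
        \<delta> * deriv (deriv f) a / deriv f a - 2 * cnj a) (at 0)"
      by (rule derivative_eq_intros d1 refl | use f'a in \<open>simp add: \<mu>0 field_simps power2_eq_square\<close>)+
    then show "(deriv F has_field_derivative \<delta> * deriv (deriv f) a / deriv f a - 2 * cnj a) (at 0)"
      by (rule has_field_derivative_transform_within_open[of _ _ _ "ball 0 1"]) (auto simp: F')
  qed
  ultimately show ?thesis by (simp add: \<delta>_def)
qed

section \<open>The radius of inverse convexity\<close>

lemma P_alpha_diff: "P_alpha \<alpha> x - P_alpha \<alpha> y = (x - y) * (4 - (1 + \<alpha>) * (x + y))"
  by (simp add: P_alpha_def algebra_simps power2_eq_square)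

text \<open>Here (1 + \<open>\<alpha>\<close>)(x + y) < 4, so the second factor in
  \<open>P_alpha_diff\<close> is positive. Monotonicity gives both uniqueness of the root and the
  sign of the polynomial on either side of it.\<close>

lemma P_alpha_strict_mono:
  assumes "0 \<le> \<alpha>" "\<alpha> < 1" "0 < x" "x < y" "y < 1"
  shows "P_alpha \<alpha> x < P_alpha \<alpha> y"
proof -
  have "(1 + \<alpha>) * (y + x) < 2 * 2"
    using assms by (intro mult_strict_mono) auto
  then have "0 < (y - x) * (4 - (1 + \<alpha>) * (y + x))"
    using assms by simp
  then show ?thesis using P_alpha_diff[of \<alpha> y x] by simp
qed

lemma P_alpha_le_0_iff:
  assumes "x\<^sup>2 < 1"
  shows "P_alpha \<alpha> x \<le> 0 \<longleftrightarrow> \<alpha> \<le> (1 - 4 * x + x\<^sup>2) / (1 - x\<^sup>2)"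
  using assms by (simp add: P_alpha_def field_simps)

text \<open>Since g' = -f'/f^2, logarithmic differentiation gives z g''/g' = z f''/f' - 2 z f'/f,
  and the last term cancels against -2 z g'/g = 2 z f'/f.\<close>

lemma inverse_convexity_expression:
  fixes f g :: "complex \<Rightarrow> complex"
  assumes U: "open U" "z \<in> U" and f: "f holomorphic_on U" and nz: "\<And>w. w \<in> U \<Longrightarrow> f w \<noteq> 0"
    and g: "\<And>w. w \<in> U \<Longrightarrow> g w = 1 / f w" and f': "deriv f z \<noteq> 0"
  shows "deriv g z \<noteq> 0"
    and "1 + z * deriv (deriv g) z / deriv g z - 2 * z * deriv g z / g z = 1 + z * deriv (deriv f) z / deriv f z"
proof -
  have fd: "(f has_field_derivative deriv f w) (at w)" if "w \<in> U" for w
    using that U by (intro holomorphic_derivI[OF f]) auto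
  have fd2: "(deriv f has_field_derivative deriv (deriv f) w) (at w)" if "w \<in> U" for w
    using that U by (intro holomorphic_derivI[OF holomorphic_deriv[OF f]]) auto
  have g1: "deriv g w = - deriv f w / (f w)\<^sup>2" if "w \<in> U" for w
  proof (rule DERIV_imp_deriv)
    have "((\<lambda>w. 1 / f w) has_field_derivative - deriv f w / (f w)\<^sup>2) (at w)"
      using fd[OF that] nz[OF that] by (auto intro!: derivative_eq_intros simp: power2_eq_square)
    then show "(g has_field_derivative - deriv f w / (f w)\<^sup>2) (at w)"
      by (rule has_field_derivative_transform_within_open[OF _ U(1) that]) (simp add: g)
  qed
  have g2: "deriv (deriv g) z = - deriv (deriv f) z / (f z)\<^sup>2 + 2 * (deriv f z)\<^sup>2 / (f z)^3"
  proof (rule DERIV_imp_deriv)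
    have "((\<lambda>w. - deriv f w / (f w)\<^sup>2) has_field_derivative
        - deriv (deriv f) z / (f z)\<^sup>2 + 2 * (deriv f z)\<^sup>2 / (f z)^3) (at z)"
      by (rule derivative_eq_intros fd[OF U(2)] fd2[OF U(2)] refl |
          use nz[OF U(2)] in \<open>simp add: field_simps power2_eq_square power3_eq_cube\<close>)+
    then show "(deriv g has_field_derivative
        - deriv (deriv f) z / (f z)\<^sup>2 + 2 * (deriv f z)\<^sup>2 / (f z)^3) (at z)"
      by (rule has_field_derivative_transform_within_open[OF _ U]) (simp add: g1)
  qed
  show "deriv g z \<noteq> 0" using g1[OF U(2)] f' nz[OF U(2)] by simp
  show "1 + z * deriv (deriv g) z / deriv g z - 2 * z * deriv g z / g z = 1 + z * deriv (deriv f) z / deriv f z"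
    unfolding g2 g1[OF U(2)] g[OF U(2)] using f' nz[OF U(2)]
    by (simp add: field_simps power2_eq_square power3_eq_cube)
qed

lemma univalent_mero_inv_convexity_lower_bound:
  assumes g: "univalent_mero g" and z: "0 < cmod z" "cmod z < 1"
  shows "g z \<noteq> 0" "deriv g z \<noteq> 0"
    and "(1 - 4 * cmod z + (cmod z)\<^sup>2) / (1 - (cmod z)\<^sup>2)
      \<le> Re (1 + z * deriv (deriv g) z / deriv g z - 2 * z * deriv g z / g z)"
proof -
  obtain h where h: "h holomorphic_on ball 0 1" and gh: "\<And>z. z \<in> ball 0 1 - {0} \<Longrightarrow> g z = 1 / z + h z"
    and inj: "inj_on g (ball 0 1 - {0})" and gnz: "\<And>z. z \<in> ball 0 1 - {0} \<Longrightarrow> g z \<noteq> 0"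
    using g unfolding univalent_mero_def by auto
  \<comment> \<open>The reciprocal of \<open>g\<close>, written so that it is holomorphic at 0 with
    value 0.\<close>
  define f where "f = (\<lambda>z. z / (1 + z * h z))"
  have den: "1 + z * h z \<noteq> 0" if "z \<in> ball 0 1" for z
  proof (cases "z = 0")
    case False
    then have "g z * z = 1 + z * h z" using gh[of z] that by (simp add: field_simps)
    then show ?thesis using gnz[of z] that False by (metis DiffI mult_eq_0_iff singletonD)
  qed simp
  have f: "f holomorphic_on ball 0 1"
    unfolding f_def using h den by (intro holomorphic_intros) auto
  have fg: "f z = 1 / g z" if "z \<in> ball 0 1 - {0}" for z
    using that den[of z] by (simp add: f_def gh field_simps)
  have f0: "f 0 = 0" by (simp add: f_def)
  have fnz: "f z \<noteq> 0" if "z \<in> ball 0 1 - {0}" for z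
    using fg gnz that by simp
  have injf: "inj_on f (ball 0 1)"
  proof (rule inj_onI)
    fix z w assume zw: "z \<in> ball 0 1" "w \<in> ball 0 1" "f z = f w"
    show "z = w"
    proof (cases "z = 0 \<or> w = 0")
      case True then show ?thesis using zw f0 fnz by (metis DiffI singletonD)
    next
      case False
      then have "g z = g w" using zw fg[of z] fg[of w] by simp
      then show ?thesis using inj_onD[OF inj] zw False by auto
    qed
  qed
  have zU: "z \<in> ball 0 1 - {0}" using z by auto
  have f': "deriv f z \<noteq> 0"
    using holomorphic_injective_imp_regular[OF f _ injf] z by simp
  note expr = inverse_convexity_expression[OF _ zU holomorphic_on_subset[OF f] fnz, of g]
  show "g z \<noteq> 0" using gnz zU by auto
  show "deriv g z \<noteq> 0"
    using f' fg gnz by (intro expr) (auto simp: open_delete)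
  define w where "w = z * deriv (deriv f) z / deriv f z"
  define \<rho> where "\<rho> = cmod z"
  \<comment> \<open>Multiplying by z confines \<open>w\<close> to a disc: (1 -
    \<open>\<rho>\<^sup>2\<close>) w lies within 4 \<open>\<rho>\<close> of 2
    \<open>\<rho>\<^sup>2\<close>. The leftmost possible real part yields the bound.\<close>
  have "cmod (z * ((1 - (cmod z)\<^sup>2) * deriv (deriv f) z / deriv f z - 2 * cnj z)) \<le> \<rho> * 4"
    unfolding norm_mult \<rho>_def using univalent_pre_schwarzian_bound[OF f injf z(2)] by (intro mult_left_mono) auto
  also have "z * ((1 - (cmod z)\<^sup>2) * deriv (deriv f) z / deriv f z - 2 * cnj z) = of_real (1 - \<rho>\<^sup>2) * w - of_real (2 * \<rho>\<^sup>2)"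
    using complex_norm_square[of z] by (simp add: w_def \<rho>_def algebra_simps)
  finally have "\<bar>Re (of_real (1 - \<rho>\<^sup>2) * w - of_real (2 * \<rho>\<^sup>2))\<bar> \<le> \<rho> * 4"
    using abs_Re_le_cmod order_trans by blast
  then have "1 - 4 * \<rho> + \<rho>\<^sup>2 \<le> (1 - \<rho>\<^sup>2) * (1 + Re w)"
    by (simp add: algebra_simps)
  moreover have "0 < 1 - \<rho>\<^sup>2" using z by (simp add: \<rho>_def power_less_one_iff)
  ultimately have "(1 - 4 * \<rho> + \<rho>\<^sup>2) / (1 - \<rho>\<^sup>2) \<le> 1 + Re w"
    by (simp add: pos_divide_le_eq mult.commute)
  moreover have "1 + z * deriv (deriv g) z / deriv g z - 2 * z * deriv g z / g z = 1 + w"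
    unfolding w_def using f' fg gnz by (intro expr) (auto simp: open_delete)
  ultimately show "(1 - 4 * cmod z + (cmod z)\<^sup>2) / (1 - (cmod z)\<^sup>2)
      \<le> Re (1 + z * deriv (deriv g) z / deriv g z - 2 * z * deriv g z / g z)"
    by (simp only: \<rho>_def plus_complex.sel one_complex.sel)
qed

section \<open>Sharpness: the reciprocal of the Koebe function z / (1 - z)^2\<close>

lemma univalent_mero_inverse_koebe: "univalent_mero (\<lambda>z. (1 - z)\<^sup>2 / z)"
  unfolding univalent_mero_def
proof (intro conjI exI ballI)
  show "(\<lambda>z::complex. z - 2) holomorphic_on ball 0 1" by (intro holomorphic_intros)
  show "(1 - z)\<^sup>2 / z = 1 / z + (z - 2)" if "z \<in> ball 0 1 - {0}" for z :: complex
    using that by (simp add: field_simps power2_eq_square)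
  show "(1 - z)\<^sup>2 / z \<noteq> 0" if "z \<in> ball 0 1 - {0}" for z :: complex
    using that by auto
  show "inj_on (\<lambda>z::complex. (1 - z)\<^sup>2 / z) (ball 0 1 - {0})"
  proof (rule inj_onI)
    fix z w :: complex
    assume zw: "z \<in> ball 0 1 - {0}" "w \<in> ball 0 1 - {0}" "(1 - z)\<^sup>2 / z = (1 - w)\<^sup>2 / w"
    \<comment> \<open>Clearing denominators leaves this product. Its second factor vanishes only for
      z w = 1, impossible inside the unit disc.\<close>
    then have "(z - w) * (z * w - 1) = 0"
      by (simp add: field_simps power2_eq_square)
    moreover have "cmod z * cmod w < 1"
      using zw mult_strict_mono[of "cmod z" 1 "cmod w" 1] by simp
    then have "z * w \<noteq> 1" by (metis less_irrefl norm_mult norm_one)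
    ultimately show "z = w" by simp
  qed
qed

text \<open>For the Koebe function the expression is (1 + 4z + z^2) / (1 - z^2). At z = -x this
  equals the general lower bound at radius x, which is therefore attained.\<close>

lemma inverse_koebe_convexity_expression:
  fixes x :: real
  assumes x: "0 < x" "x < 1"
  defines "g \<equiv> \<lambda>z::complex. (1 - z)\<^sup>2 / z" and "z \<equiv> - complex_of_real x"
  shows "1 + z * deriv (deriv g) z / deriv g z - 2 * z * deriv g z / g z
    = of_real ((1 - 4 * x + x\<^sup>2) / (1 - x\<^sup>2))"
proof -
  have g1: "deriv g w = 1 - 1 / w\<^sup>2" if "w \<noteq> 0" for w
  proof (rule DERIV_imp_deriv)
    show "(g has_field_derivative 1 - 1 / w\<^sup>2) (at w)"
      unfolding g_def using that
      by (auto intro!: derivative_eq_intros simp: field_simps power2_eq_square)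
  qed
  have z: "z \<noteq> 0" using x by (simp add: z_def)
  have g2: "deriv (deriv g) z = 2 / z^3"
  proof (rule DERIV_imp_deriv)
    have "((\<lambda>w. 1 - 1 / w\<^sup>2) has_field_derivative 2 / z^3) (at z)"
      using z by (auto intro!: derivative_eq_intros simp: field_simps power2_eq_square power3_eq_cube)
    then show "(deriv g has_field_derivative 2 / z^3) (at z)"
      by (rule has_field_derivative_transform_within_open[of _ _ _ "- {0}"]) (use z in \<open>auto simp: g1\<close>)
  qed
  have x2: "x\<^sup>2 < 1" using x by (simp add: power_less_one_iff)
  have nz: "1 - z \<noteq> 0" "1 + z \<noteq> 0" "1 - z\<^sup>2 \<noteq> 0"
    using x x2 by (auto simp: z_def complex_eq_iff power2_eq_square)
  have "1 + z * deriv (deriv g) z / deriv g z - 2 * z * deriv g z / g z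
    = 1 - 2 / (1 - z\<^sup>2) + 2 * (1 + z) / (1 - z)"
  proof -
    have "z * (2 / z^3) / (1 - 1 / z\<^sup>2) = - 2 / (1 - z\<^sup>2)"
    proof -
      have "1 - 1 / z\<^sup>2 = - (1 - z\<^sup>2) / z\<^sup>2" using z by (simp add: field_simps)
      then show ?thesis using z nz by (simp add: field_simps power2_eq_square power3_eq_cube)
    qed
    moreover have "2 * z * (1 - 1 / z\<^sup>2) / ((1 - z)\<^sup>2 / z) = - (2 * (1 + z) / (1 - z))"
    proof -
      have "1 - 1 / z\<^sup>2 = - ((1 - z) * (1 + z)) / z\<^sup>2" using z by (simp add: field_simps power2_eq_square)
      then show ?thesis using z nz by (simp add: power2_eq_square)
    qed
    ultimately show ?thesis unfolding g2 g1[OF z] by (simp add: g_def)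
  qed
  also have "\<dots> = (1 + 4 * z + z\<^sup>2) / (1 - z\<^sup>2)"
  proof -
    have "2 * (1 + z) / (1 - z) = 2 * (1 + z)\<^sup>2 / (1 - z\<^sup>2)"
      using nz by (simp add: divide_eq_eq eq_divide_eq) (simp add: power2_eq_square algebra_simps)
    then have "1 - 2 / (1 - z\<^sup>2) + 2 * (1 + z) / (1 - z) = ((1 - z\<^sup>2) - 2 + 2 * (1 + z)\<^sup>2) / (1 - z\<^sup>2)"
      by (simp only: add_divide_distrib[of _ _ "1 - z\<^sup>2"] diff_divide_distrib[of "1 - z\<^sup>2"] divide_self[OF nz(3)])
    then show ?thesis by (simp add: power2_eq_square algebra_simps)
  qed
  finally show ?thesis by (simp add: z_def)
qed

theorem theorem2p16:
  fixes \<alpha> r\<^sub>\<alpha> :: real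
  assumes "0 \<le> \<alpha>" "\<alpha> < 1"
    and "0 < r\<^sub>\<alpha>" "r\<^sub>\<alpha> < 1" "P_alpha \<alpha> r\<^sub>\<alpha> = 0"
  shows "(\<forall>x. 0 < x \<and> x < 1 \<and> P_alpha \<alpha> x = 0 \<longrightarrow> x = r\<^sub>\<alpha>)
    \<and> (\<forall>g. univalent_mero g \<longrightarrow> mero_inv_convex_on \<alpha> r\<^sub>\<alpha> g)
    \<and> (\<forall>r > r\<^sub>\<alpha>. \<exists>g. univalent_mero g \<and> \<not> mero_inv_convex_on \<alpha> r g)"
proof (intro conjI allI impI)
  note mono = P_alpha_strict_mono[OF assms(1,2)]
  show "x = r\<^sub>\<alpha>" if "0 < x \<and> x < 1 \<and> P_alpha \<alpha> x = 0" for x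
    using mono[of x r\<^sub>\<alpha>] mono[of r\<^sub>\<alpha> x] that assms by (cases x r\<^sub>\<alpha> rule: linorder_cases) auto
  show "mero_inv_convex_on \<alpha> r\<^sub>\<alpha> g" if g: "univalent_mero g" for g
    unfolding mero_inv_convex_on_def
  proof (intro allI impI)
    fix z :: complex assume z: "0 < cmod z \<and> cmod z < r\<^sub>\<alpha>"
    then have z1: "0 < cmod z" "cmod z < 1" using assms by auto
    have "P_alpha \<alpha> (cmod z) \<le> 0" using mono[of "cmod z" r\<^sub>\<alpha>] z assms by simp
    moreover have "(cmod z)\<^sup>2 < 1" using z1 by (simp add: power_less_one_iff)
    ultimately have "\<alpha> \<le> (1 - 4 * cmod z + (cmod z)\<^sup>2) / (1 - (cmod z)\<^sup>2)"
      using P_alpha_le_0_iff by blast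
    with univalent_mero_inv_convexity_lower_bound[OF g z1]
    show "g z \<noteq> 0 \<and> deriv g z \<noteq> 0 \<and>
        Re (1 + z * deriv (deriv g) z / deriv g z - 2 * z * deriv g z / g z) \<ge> \<alpha>"
      by simp
  qed
  show "\<exists>g. univalent_mero g \<and> \<not> mero_inv_convex_on \<alpha> r g" if "r > r\<^sub>\<alpha>" for r
  proof (intro exI conjI)
    show "univalent_mero (\<lambda>z. (1 - z)\<^sup>2 / z)" by (rule univalent_mero_inverse_koebe)
    \<comment> \<open>The minimum with 1 keeps the test point -x inside the unit disc even when r >=
      1.\<close>
    define x where "x = (r\<^sub>\<alpha> + min r 1) / 2"
    have x: "r\<^sub>\<alpha> < x" "x < r" "x < 1" "0 < x" using that assms by (auto simp: x_def min_def)
    have "0 < P_alpha \<alpha> x" using mono[of r\<^sub>\<alpha> x] x assms by simp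
    moreover have "x\<^sup>2 < 1" using x by (simp add: power_less_one_iff)
    ultimately have "(1 - 4 * x + x\<^sup>2) / (1 - x\<^sup>2) < \<alpha>"
      using P_alpha_le_0_iff[of x \<alpha>] by linarith
    then show "\<not> mero_inv_convex_on \<alpha> r (\<lambda>z. (1 - z)\<^sup>2 / z)"
      unfolding mero_inv_convex_on_def
      using x inverse_koebe_convexity_expression[of x]
      by (auto simp only: not_all not_imp Re_complex_of_real norm_minus_cancel norm_of_real intro!: exI[of _ "- complex_of_real x"])
  qed
qed

end
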